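(* Let $d\ge 1$ and let $P\subset\mathbb{R}^d$ be a set consisting of three distinct points. Then a typical compact set $E\in\mathcal{K}([0,1]^d)$ does not contain a similar copy of $P$; that is, the set of all $E\in\mathcal{K}([0,1]^d)$ which contain a similar copy of $P$ is of first category in $(\mathcal{K}([0,1]^d),d_H)$.
   Context: $\mathcal{K}([0,1]^d)$ denotes the set of all nonempty compact subsets of $[0,1]^d$ with the Hausdorff metric $d_H(E,F)=\inf\{\varepsilon>0: E\subset F^\varepsilon \text{ and } F\subset E^\varepsilon\}$, where $E^\varepsilon=\{x\in\mathbb{R}^d:\operatorname{dist}(x,E)<\varepsilon\}$. A subset of a metric space is nowhere dense if its closure has empty interior, and is of first category if it is a countable union of nowhere dense sets. A typical element of a metric space $X$ has a property if the set of elements of $X$ not having the property is of first category in $X$. For $A,B\subset\mathbb{R}^d$, $A$ is similar to $B$ if there exist $\lambda>0$ and an isometry $\varphi$ of $\mathbb{R}^d$ with $\varphi(\lambda A)=B$. A set $A$ contains a similar copy of $B$ if some subset $A'\subset A$ is similar to $B$. *)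

theory Defs
  imports "HOL-Analysis.Analysis"
begin

definition compact_subsets :: "'a::topological_space set \<Rightarrow> 'a set set"
  where "compact_subsets S = {E. E \<noteq> {} \<and> compact E \<and> E \<subseteq> S}"

definition nbhd :: "real \<Rightarrow> 'a::metric_space set \<Rightarrow> 'a set"
  where "nbhd \<epsilon> E = {x. infdist x E < \<epsilon>}"

definition hausdorff_radii :: "'a::metric_space set \<Rightarrow> 'a set \<Rightarrow> real set"
  where "hausdorff_radii E F = {\<epsilon>. 0 < \<epsilon> \<and> E \<subseteq> nbhd \<epsilon> F \<and> F \<subseteq> nbhd \<epsilon> E}"

text \<open>
  The infimum of the empty set of reals is unspecified, and the locale \<^locale>\<open>Metric_space\<close> asks for
  nonnegativity and symmetry at all arguments, hence the default value 0. It is never used for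
  nonempty bounded sets, as lemma \<open>hausdorff_radii_nonempty\<close> shows.
\<close>
definition hausdorff_dist :: "'a::metric_space set \<Rightarrow> 'a set \<Rightarrow> real"
  where "hausdorff_dist E F =
    (if hausdorff_radii E F = {} then 0 else Inf (hausdorff_radii E F))"

definition hausdorff_topology :: "'a::metric_space set \<Rightarrow> 'a set topology"
  where "hausdorff_topology S = Metric_space.mtopology (compact_subsets S) hausdorff_dist"

definition nowhere_dense_in :: "'a topology \<Rightarrow> 'a set \<Rightarrow> bool"
  where "nowhere_dense_in X N \<longleftrightarrow> N \<subseteq> topspace X \<and> X interior_of (X closure_of N) = {}"

definition first_category_in :: "'a topology \<Rightarrow> 'a set \<Rightarrow> bool"
  where "first_category_in X A \<longleftrightarrow>
    (\<exists>\<N>. countable \<N> \<and> (\<forall>N\<in>\<N>. nowhere_dense_in X N) \<and> A = \<Union>\<N>)"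

definition typical_in :: "'a topology \<Rightarrow> ('a \<Rightarrow> bool) \<Rightarrow> bool"
  where "typical_in X Q \<longleftrightarrow> first_category_in X {x \<in> topspace X. \<not> Q x}"

text \<open>Distance-preserving self-maps of a Euclidean space are automatically surjective.\<close>
definition isometry :: "('a::metric_space \<Rightarrow> 'a) \<Rightarrow> bool"
  where "isometry \<phi> \<longleftrightarrow> (\<forall>x y. dist (\<phi> x) (\<phi> y) = dist x y)"

definition similar_to :: "'a::real_normed_vector set \<Rightarrow> 'a set \<Rightarrow> bool"
  where "similar_to A B \<longleftrightarrow>
    (\<exists>c>0. \<exists>\<phi>. isometry \<phi> \<and> \<phi> ` ((\<lambda>x. c *\<^sub>R x) ` A) = B)"

definition contains_similar_copy :: "'a::real_normed_vector set \<Rightarrow> 'a set \<Rightarrow> bool"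
  where "contains_similar_copy A B \<longleftrightarrow> (\<exists>A'\<subseteq>A. similar_to A' B)"

lemma nbhd_iff:
  assumes "E \<noteq> {}"
  shows "x \<in> nbhd \<epsilon> E \<longleftrightarrow> (\<exists>y\<in>E. dist x y < \<epsilon>)"
  using assms by (simp add: nbhd_def infdist_notempty cINF_less_iff)

lemma hausdorff_radii_iff:
  assumes "E \<noteq> {}" "F \<noteq> {}"
  shows "\<epsilon> \<in> hausdorff_radii E F \<longleftrightarrow>
    0 < \<epsilon> \<and> (\<forall>x\<in>E. \<exists>y\<in>F. dist x y < \<epsilon>) \<and> (\<forall>y\<in>F. \<exists>x\<in>E. dist y x < \<epsilon>)"
  using assms by (auto simp: hausdorff_radii_def nbhd_iff subset_iff)

lemma hausdorff_radii_nonempty: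
  assumes "E \<noteq> {}" "F \<noteq> {}" "bounded E" "bounded F"
  shows "hausdorff_radii E F \<noteq> {}"
proof -
  have "bounded (E \<union> F)" using assms by simp
  then obtain B where B: "\<And>x y. x \<in> E \<union> F \<Longrightarrow> y \<in> E \<union> F \<Longrightarrow> dist x y \<le> B"
    using bounded_two_points by metis
  obtain e f where ef: "e \<in> E" "f \<in> F" using assms by blast
  have "\<bar>B\<bar> + 1 \<in> hausdorff_radii E F"
    unfolding hausdorff_radii_iff[OF assms(1,2)]
  proof (intro conjI ballI)
    fix x assume "x \<in> E"
    then have "dist x f < \<bar>B\<bar> + 1" using B[of x f] ef by simp
    then show "\<exists>y\<in>F. dist x y < \<bar>B\<bar> + 1" using ef by blast
  next
    fix y assume "y \<in> F"
    then have "dist y e < \<bar>B\<bar> + 1" using B[of y e] ef by simp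
    then show "\<exists>x\<in>E. dist y x < \<bar>B\<bar> + 1" using ef by blast
  qed simp
  then show ?thesis by blast
qed

lemma hausdorff_radii_bdd_below: "bdd_below (hausdorff_radii E F)"
  by (rule bdd_belowI[of _ 0]) (simp add: hausdorff_radii_def)

lemma hausdorff_dist_nonneg: "0 \<le> hausdorff_dist E F"
  unfolding hausdorff_dist_def
  by (auto intro!: cInf_greatest simp: hausdorff_radii_def)

lemma hausdorff_dist_commute: "hausdorff_dist E F = hausdorff_dist F E"
proof -
  have "hausdorff_radii E F = hausdorff_radii F E"
    by (auto simp: hausdorff_radii_def)
  then show ?thesis by (simp add: hausdorff_dist_def)
qed

lemma hausdorff_dist_less_iff:
  assumes "E \<noteq> {}" "F \<noteq> {}" "bounded E" "bounded F"
  shows "hausdorff_dist E F < r \<longleftrightarrow> (\<exists>\<epsilon>\<in>hausdorff_radii E F. \<epsilon> < r)"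
  using hausdorff_radii_nonempty[OF assms] hausdorff_radii_bdd_below[of E F]
  by (simp add: hausdorff_dist_def cInf_less_iff)

lemma Metric_space_hausdorff_dist: "Metric_space (compact_subsets S) hausdorff_dist"
proof
  fix E F :: "'a set"
  show "0 \<le> hausdorff_dist E F" by (rule hausdorff_dist_nonneg)
  show "hausdorff_dist E F = hausdorff_dist F E" by (rule hausdorff_dist_commute)
next
  fix E F assume "E \<in> compact_subsets S" "F \<in> compact_subsets S"
  then have EF: "E \<noteq> {}" "F \<noteq> {}" "compact E" "compact F" "bounded E" "bounded F"
    by (auto simp: compact_subsets_def compact_imp_bounded)
  have sub: "A \<subseteq> B"
    if 0: "hausdorff_dist A B = 0" and AB: "A \<noteq> {}" "B \<noteq> {}" "compact B" "bounded A" "bounded B"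
    for A B :: "'a set"
  proof
    fix x assume x: "x \<in> A"
    have "x \<in> closure B"
      unfolding closure_approachable
    proof (intro allI impI)
      fix e :: real assume "0 < e"
      then obtain \<epsilon> where \<epsilon>: "\<epsilon> \<in> hausdorff_radii A B" "\<epsilon> < e"
        using hausdorff_dist_less_iff[of A B e] 0 AB by auto
      then obtain y where "y \<in> B" "dist x y < \<epsilon>"
        using x AB by (auto simp: hausdorff_radii_iff)
      then show "\<exists>y\<in>B. dist y x < e" using \<epsilon> by (force simp: dist_commute)
    qed
    then show "x \<in> B" using AB by (simp add: compact_imp_closed)
  qed
  show "hausdorff_dist E F = 0 \<longleftrightarrow> E = F"
  proof
    assume "hausdorff_dist E F = 0"
    then show "E = F" using sub[of E F] sub[of F E] EF by (auto simp: hausdorff_dist_commute)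
  next
    assume "E = F"
    then have "\<epsilon> \<in> hausdorff_radii E F" if "0 < \<epsilon>" for \<epsilon>
      using that EF by (metis dist_self hausdorff_radii_iff)
    then have "hausdorff_dist E F < r" if "0 < r" for r
      using that EF hausdorff_dist_less_iff[of E F r]
      by (metis field_sum_of_halves half_gt_zero less_add_same_cancel1)
    then show "hausdorff_dist E F = 0"
      using hausdorff_dist_nonneg[of E F] by (metis less_eq_real_def less_irrefl)
  qed
next
  fix E F G
  assume "E \<in> compact_subsets S" "F \<in> compact_subsets S" "G \<in> compact_subsets S"
  then have ne: "E \<noteq> {}" "F \<noteq> {}" "G \<noteq> {}" and bd: "bounded E" "bounded F" "bounded G"
    by (auto simp: compact_subsets_def compact_imp_bounded)
  show "hausdorff_dist E G \<le> hausdorff_dist E F + hausdorff_dist F G"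
  proof (rule field_le_epsilon)
    fix e :: real assume e: "0 < e"
    obtain a where a: "a \<in> hausdorff_radii E F" "a < hausdorff_dist E F + e / 2"
      using hausdorff_dist_less_iff[of E F "hausdorff_dist E F + e / 2"] ne bd e by auto
    obtain b where b: "b \<in> hausdorff_radii F G" "b < hausdorff_dist F G + e / 2"
      using hausdorff_dist_less_iff[of F G "hausdorff_dist F G + e / 2"] ne bd e by auto
    have "a + b \<in> hausdorff_radii E G"
      unfolding hausdorff_radii_iff[OF ne(1,3)]
    proof (intro conjI ballI)
      show "0 < a + b" using a b by (simp add: hausdorff_radii_def)
    next
      fix x assume "x \<in> E"
      then obtain y where "y \<in> F" "dist x y < a"
        using a ne by (auto simp: hausdorff_radii_iff)
      moreover from this obtain z where "z \<in> G" "dist y z < b"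
        using b ne by (auto simp: hausdorff_radii_iff)
      ultimately show "\<exists>z\<in>G. dist x z < a + b"
        using dist_triangle[of x _ y] by (intro bexI[of _ z]) (smt (verit))+
    next
      fix z assume "z \<in> G"
      then obtain y where "y \<in> F" "dist z y < b"
        using b ne by (auto simp: hausdorff_radii_iff)
      moreover from this obtain x where "x \<in> E" "dist y x < a"
        using a ne by (auto simp: hausdorff_radii_iff)
      ultimately show "\<exists>x\<in>E. dist z x < a + b"
        using dist_triangle[of z _ y] by (intro bexI[of _ x]) (smt (verit))+
    qed
    moreover have "a + b < hausdorff_dist E F + hausdorff_dist F G + e"
      using a b by simp
    ultimately show "hausdorff_dist E G \<le> hausdorff_dist E F + hausdorff_dist F G + e"
      using hausdorff_dist_less_iff[of E G] ne bd by (meson less_imp_le)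
  qed
qed

lemma topspace_hausdorff_topology [simp]: "topspace (hausdorff_topology S) = compact_subsets S"
  unfolding hausdorff_topology_def
  by (rule Metric_space.topspace_mtopology[OF Metric_space_hausdorff_dist])

end

theory Submission
  imports Defs
begin

text \<open>
  Similarity of triples is determined by the two distance ratios. For fixed \<open>a, b > 0\<close>, a point
  completing a given pair to a triple with these ratios lies on a sphere around a point of the pair,
  whichever place it takes in the triple. Hence, moving the points of a finite net one after another
  off finitely many spheres, one approximates any compact set by finite sets without such a triple.
  A finite set without such triples has positive Hausdorff distance from the compact sets that
  contain a triple with these ratios and with first side at least \<open>1 / (n + 1)\<close>, so the latter form
  a nowhere dense set; their union over \<open>n\<close> covers all compact sets containing a copy.
\<close>

text \<open>The condition \<open>x \<noteq> y\<close> excludes the degenerate solution x = y = z;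
  for positive \<open>a\<close> and \<open>b\<close> it makes all three points distinct.\<close>

definition ratio_triple :: "real \<Rightarrow> real \<Rightarrow> 'a::metric_space \<Rightarrow> 'a \<Rightarrow> 'a \<Rightarrow> bool"
  where "ratio_triple a b x y z \<longleftrightarrow>
    x \<noteq> y \<and> dist x z = a * dist x y \<and> dist y z = b * dist x y"

definition ratio_free :: "real \<Rightarrow> real \<Rightarrow> 'a::metric_space set \<Rightarrow> bool"
  where "ratio_free a b F \<longleftrightarrow> (\<forall>x\<in>F. \<forall>y\<in>F. \<forall>z\<in>F. \<not> ratio_triple a b x y z)"

text \<open>A similarity multiplies all distances by one factor, which cancels in quotients of
  distances.\<close>

lemma contains_similar_copy_ratio_triple:
  assumes "contains_similar_copy E {p, q, r}" "p \<noteq> q"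
  obtains x y z where "x \<in> E" "y \<in> E" "z \<in> E"
    "ratio_triple (dist p r / dist p q) (dist q r / dist p q) x y z"
proof -
  obtain A c \<phi> where A: "A \<subseteq> E" "c > 0" "isometry \<phi>" "\<phi> ` ((\<lambda>x. c *\<^sub>R x) ` A) = {p, q, r}"
    using assms(1) by (auto simp: contains_similar_copy_def similar_to_def)
  then obtain x y z where xyz: "x \<in> A" "y \<in> A" "z \<in> A"
    "p = \<phi> (c *\<^sub>R x)" "q = \<phi> (c *\<^sub>R y)" "r = \<phi> (c *\<^sub>R z)"
    by (smt (verit) image_iff insertCI)
  have d: "dist (\<phi> (c *\<^sub>R u)) (\<phi> (c *\<^sub>R v)) = c * dist u v" for u v
    using A(2,3) by (simp add: isometry_def dist_norm flip: scaleR_diff_right)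
  have "ratio_triple (dist p r / dist p q) (dist q r / dist p q) x y z"
    using assms(2) A(2) unfolding ratio_triple_def xyz(4-6) d by auto
  then show ?thesis using that A(1) xyz(1-3) by blast
qed

text \<open>Spheres are Lebesgue null, also for radius 0, so finitely many of them cannot cover a
  nonempty open set. The assumption on \<open>w\<close> puts such an open part of \<open>S\<close>
  within \<open>e\<close> of \<open>w\<close>.\<close>

lemma ex_avoiding_spheres:
  fixes w :: "'a::euclidean_space"
  assumes "w \<in> closure (interior S)" "0 < e" "finite C" "finite R"
  obtains v where "v \<in> S" "dist w v < e" "\<And>c r. c \<in> C \<Longrightarrow> r \<in> R \<Longrightarrow> dist c v \<noteq> r"
proof -
  let ?U = "ball w e \<inter> interior S" and ?B = "\<Union>(c, r)\<in>C \<times> R. sphere c r"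
  have "?U \<noteq> {}"
    using assms(1,2) by (force simp: closure_approachable dist_commute)
  then have "\<not> negligible ?U"
    by (intro open_not_negligible open_Int) auto
  moreover have "negligible ?B"
    using assms(3,4) by (intro negligible_Union) (auto simp: negligible_sphere)
  ultimately have "\<not> ?U \<subseteq> ?B"
    using negligible_subset by blast
  then obtain v where "v \<in> ?U" "v \<notin> ?B" by blast
  then show ?thesis
    using that[of v] interior_subset[of S] by auto
qed

text \<open>The points of a triple are distinct, so \<open>v\<close> takes only one place. One of
  the two equations then fixes its distance to an old point; the three excluded values belong to
  \<open>v\<close> in third, second and first place, respectively.\<close>

lemma ratio_free_insert:
  assumes F: "ratio_free a b F" and ab: "0 < a" "0 < b"
    and v: "\<And>x y z. x \<in> F \<Longrightarrow> y \<in> F \<Longrightarrow> z \<in> F \<Longrightarrow>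
      dist z v \<noteq> a * dist x y \<and> dist z v \<noteq> dist x y / a \<and> dist z v \<noteq> dist x y / b"
  shows "ratio_free a b (insert v F)"
  unfolding ratio_free_def
proof (intro ballI notI)
  fix x y z
  assume xyz: "x \<in> insert v F" "y \<in> insert v F" "z \<in> insert v F" and t: "ratio_triple a b x y z"
  then have ne: "x \<noteq> y" "x \<noteq> z" "y \<noteq> z"
    using ab by (auto simp: ratio_triple_def)
  consider "x \<in> F" "y \<in> F" "z \<in> F" | "z = v" "x \<in> F" "y \<in> F" | "x = v" "y \<in> F" "z \<in> F"
    | "y = v" "x \<in> F" "z \<in> F"
    using xyz ne by blast
  then show False
  proof cases
    case 1
    then show ?thesis using F t by (auto simp: ratio_free_def)
  next
    case 2
    then show ?thesis using t v[of x y x] by (auto simp: ratio_triple_def)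
  next
    case 3
    then have "dist y v = dist y z / b"
      using t ab by (auto simp: ratio_triple_def dist_commute)
    then show ?thesis using v[of y z y] 3 by auto
  next
    case 4
    then have "dist x v = dist x z / a"
      using t ab by (auto simp: ratio_triple_def)
    then show ?thesis using v[of x z x] 4 by auto
  qed
qed

text \<open>Points are added one at a time: each new one has to avoid only the finitely many spheres
  determined by the points already chosen.\<close>

lemma ratio_free_perturbation:
  fixes K :: "'a::euclidean_space set"
  assumes "finite K" "K \<subseteq> closure (interior S)" "0 < e" "0 < a" "0 < b"
  shows "\<exists>F. finite F \<and> F \<subseteq> S \<and> ratio_free a b F \<and>
    (\<forall>x\<in>K. \<exists>y\<in>F. dist x y < e) \<and> (\<forall>y\<in>F. \<exists>x\<in>K. dist x y < e)"
  using assms(1,2)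
proof induction
  case empty
  then show ?case by (intro exI[of _ "{}"]) (auto simp: ratio_free_def)
next
  case (insert w K)
  then obtain F where F: "finite F" "F \<subseteq> S" "ratio_free a b F"
    "\<forall>x\<in>K. \<exists>y\<in>F. dist x y < e" "\<forall>y\<in>F. \<exists>x\<in>K. dist x y < e"
    by auto
  \<comment> \<open>Finitely many radii: three for each distance within \<open>F\<close>, one per
    place of the new point in a triple.\<close>
  let ?D = "(\<lambda>(x, y). dist x y) ` (F \<times> F)"
  let ?R = "(\<lambda>t. a * t) ` ?D \<union> (\<lambda>t. t / a) ` ?D \<union> (\<lambda>t. t / b) ` ?D"
  obtain v where v: "v \<in> S" "dist w v < e" "\<And>c r. c \<in> F \<Longrightarrow> r \<in> ?R \<Longrightarrow> dist c v \<noteq> r"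
    using ex_avoiding_spheres[of w S e F ?R] insert.prems assms(3) F(1) by blast
  have "ratio_free a b (insert v F)"
  proof (rule ratio_free_insert[OF F(3) assms(4,5)])
    fix x y z assume xyz: "x \<in> F" "y \<in> F" "z \<in> F"
    then have "dist x y \<in> ?D" by force
    then show "dist z v \<noteq> a * dist x y \<and> dist z v \<noteq> dist x y / a \<and> dist z v \<noteq> dist x y / b"
      using v(3)[OF xyz(3)] by blast
  qed
  then show ?case
    using F v(1,2) by (intro exI[of _ "insert v F"]) auto
qed

lemma ratio_free_dense:
  fixes E :: "'a::euclidean_space set"
  assumes "S \<subseteq> closure (interior S)" "E \<in> compact_subsets S" "0 < e" "0 < a" "0 < b"
  obtains F where "F \<in> compact_subsets S" "finite F" "ratio_free a b F" "hausdorff_dist E F < e"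
proof -
  have E: "E \<noteq> {}" "compact E" "E \<subseteq> S"
    using assms(2) by (auto simp: compact_subsets_def)
  obtain K where K: "finite K" "K \<subseteq> E" "E \<subseteq> (\<Union>x\<in>K. ball x (e / 4))"
    using compactE_image[OF E(2), of E "\<lambda>x. ball x (e / 4)"] assms(3) by force
  have "K \<noteq> {}" using K(3) E(1) by auto
  have K': "K \<subseteq> closure (interior S)" and e: "0 < e / 4"
    using K(2) E(3) assms(1,3) by auto
  obtain F where F: "finite F" "F \<subseteq> S" "ratio_free a b F"
    "\<forall>x\<in>K. \<exists>y\<in>F. dist x y < e / 4" "\<forall>y\<in>F. \<exists>x\<in>K. dist x y < e / 4"
    using ratio_free_perturbation[OF K(1) K' e assms(4,5)] by (elim exE conjE)
  have "F \<noteq> {}" using F(4) \<open>K \<noteq> {}\<close> by auto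
  \<comment> \<open>A quarter of \<open>e\<close> is spent on the net \<open>K\<close>, another on
    moving its points; stopping at \<open>e / 2\<close> makes the final inequality strict.\<close>
  have "e / 2 \<in> hausdorff_radii E F"
    unfolding hausdorff_radii_iff[OF E(1) \<open>F \<noteq> {}\<close>]
  proof (intro conjI ballI)
    show "0 < e / 2" using assms(3) by simp
  next
    fix x assume "x \<in> E"
    then obtain k where k: "k \<in> K" "dist k x < e / 4" using K(3) by auto
    then obtain y where "y \<in> F" "dist k y < e / 4" using F(4) by auto
    then show "\<exists>y\<in>F. dist x y < e / 2"
      using k dist_triangle3[of x y k] by (intro bexI[of _ y]) auto
  next
    fix y assume "y \<in> F"
    then obtain k where k: "k \<in> K" "dist k y < e / 4" using F(5) by auto
    then have "dist y k < e / 2"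
      using zero_le_dist[of k y] by (subst dist_commute) linarith
    then show "\<exists>x\<in>E. dist y x < e / 2"
      using k(1) K(2) by blast
  qed
  then have "hausdorff_dist E F < e"
    using hausdorff_dist_less_iff[of E F e] E \<open>F \<noteq> {}\<close> F(1) assms(3)
    by (auto simp: compact_imp_bounded finite_imp_bounded intro!: bexI[of _ "e / 2"])
  moreover have "F \<in> compact_subsets S"
    using F(1,2) \<open>F \<noteq> {}\<close> by (simp add: compact_subsets_def finite_imp_compact)
  ultimately show ?thesis
    using that F(1,3) by blast
qed

text \<open>For \<open>s > 0\<close> this is at most 0 exactly on the ratio triples with first side
  at least \<open>s\<close>. The entry \<open>s - dist x y\<close> penalises collapsed triples, on
  which the other two entries vanish.\<close>

definition ratio_defect :: "real \<Rightarrow> real \<Rightarrow> real \<Rightarrow> 'a::metric_space \<times> 'a \<times> 'a \<Rightarrow> real"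
  where "ratio_defect a b s = (\<lambda>(x, y, z).
    max (s - dist x y) (max \<bar>dist x z - a * dist x y\<bar> \<bar>dist y z - b * dist x y\<bar>))"

text \<open>Moving both endpoints by at most \<open>d\<close> changes a distance by at most
  \<open>2 * d\<close>, hence its multiples by \<open>a\<close> and \<open>b\<close> by at most
  \<open>2 * a * d\<close> and \<open>2 * b * d\<close>. The constant bounds the change of all three
  entries of the maximum.\<close>

lemma ratio_defect_perturb:
  assumes "0 < a" "0 < b" "dist x x' \<le> d" "dist y y' \<le> d" "dist z z' \<le> d"
  shows "ratio_defect a b s (x, y, z) \<le> ratio_defect a b s (x', y', z') + 2 * (1 + a + b) * d"
proof -
  have d: "\<bar>dist u v - dist u' v'\<bar> \<le> 2 * d" if "dist u u' \<le> d" "dist v v' \<le> d"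
    for u v u' v' :: 'a
    using that dist_triangle[of u v u'] dist_triangle[of u' v v'] dist_triangle[of u' v' u]
      dist_triangle[of u v' v] by (simp add: dist_commute)
  have *: "\<bar>t * dist x y - t * dist x' y'\<bar> \<le> t * (2 * d)" if "0 < t" for t
  proof -
    have "\<bar>t * dist x y - t * dist x' y'\<bar> = t * \<bar>dist x y - dist x' y'\<bar>"
      using that by (simp add: abs_mult flip: right_diff_distrib)
    also have "\<dots> \<le> t * (2 * d)"
      using d[OF assms(3,4)] that by (intro mult_left_mono) auto
    finally show ?thesis .
  qed
  have "0 \<le> d" using assms(3) zero_le_dist[of x x'] by linarith
  then have "0 \<le> a * d" "0 \<le> b * d" using assms(1,2) by auto
  let ?M = "ratio_defect a b s (x', y', z')"
  have "s - dist x' y' \<le> ?M" "\<bar>dist x' z' - a * dist x' y'\<bar> \<le> ?M"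
    "\<bar>dist y' z' - b * dist x' y'\<bar> \<le> ?M"
    by (simp_all add: ratio_defect_def)
  moreover have "2 * (1 + a + b) * d = 2 * d + a * (2 * d) + b * (2 * d)"
    by (simp add: algebra_simps)
  ultimately have "s - dist x y \<le> ?M + 2 * (1 + a + b) * d"
    "\<bar>dist x z - a * dist x y\<bar> \<le> ?M + 2 * (1 + a + b) * d"
    "\<bar>dist y z - b * dist x y\<bar> \<le> ?M + 2 * (1 + a + b) * d"
    using d[OF assms(3,4)] d[OF assms(3,5)] d[OF assms(4,5)] *[OF assms(1)] *[OF assms(2)] \<open>0 \<le> d\<close>
      \<open>0 \<le> a * d\<close> \<open>0 \<le> b * d\<close> by linarith+
  then show ?thesis
    by (subst (1) ratio_defect_def) simp
qed

text \<open>The defect has a positive minimum over the finitely many triples of \<open>F\<close>. A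
  set \<open>G\<close> too close to \<open>F\<close> would carry its triple, of defect at most 0, to
  a triple of \<open>F\<close> with defect below that minimum.\<close>

lemma ratio_free_separated:
  assumes "finite F" "F \<noteq> {}" "ratio_free a b F" "0 < a" "0 < b" "0 < s"
  shows "\<exists>d>0. \<forall>G. G \<noteq> {} \<and> bounded G \<and>
    (\<exists>x\<in>G. \<exists>y\<in>G. \<exists>z\<in>G. ratio_triple a b x y z \<and> s \<le> dist x y) \<longrightarrow> d \<le> hausdorff_dist F G"
proof -
  define m where "m = Min (ratio_defect a b s ` (F \<times> F \<times> F))"
  have fin: "finite (ratio_defect a b s ` (F \<times> F \<times> F))" using assms(1) by simp
  have pos: "0 < ratio_defect a b s (x, y, z)" if "x \<in> F" "y \<in> F" "z \<in> F" for x y z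
  proof (rule ccontr)
    assume "\<not> ?thesis"
    then have "ratio_triple a b x y z"
      using assms(6) by (auto simp: ratio_defect_def ratio_triple_def)
    then show False using assms(3) that by (auto simp: ratio_free_def)
  qed
  have "0 < m"
    unfolding m_def using fin assms(2) pos by (subst Min_gr_iff) auto
  \<comment> \<open>Chosen so that moving each point by less than \<open>d\<close> changes the
    defect by less than \<open>m\<close>.\<close>
  define d where "d = m / (2 * (1 + a + b))"
  have "0 < d" using \<open>0 < m\<close> assms(4,5) by (simp add: d_def)
  moreover have "d \<le> hausdorff_dist F G"
    if G: "G \<noteq> {}" "bounded G" "x \<in> G" "y \<in> G" "z \<in> G" "ratio_triple a b x y z" "s \<le> dist x y"
    for G x y z
  proof (rule ccontr)
    assume "\<not> ?thesis"
    then obtain r where r: "r \<in> hausdorff_radii F G" "r < d"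
      using hausdorff_dist_less_iff[of F G d] assms(1,2) G by (auto simp: finite_imp_bounded)
    then have near: "\<exists>u\<in>F. dist u w \<le> r" if "w \<in> G" for w
      using that assms(2) G(1) by (force simp: hausdorff_radii_iff dist_commute)
    obtain x' y' z' where n: "x' \<in> F" "y' \<in> F" "z' \<in> F" "dist x' x \<le> r" "dist y' y \<le> r" "dist z' z \<le> r"
      using near G(3-5) by metis
    have "m \<le> ratio_defect a b s (x', y', z')"
      unfolding m_def using fin n by (intro Min_le) auto
    also have "\<dots> \<le> ratio_defect a b s (x, y, z) + 2 * (1 + a + b) * r"
      by (rule ratio_defect_perturb[OF assms(4,5) n(4-6)])
    also have "\<dots> \<le> 2 * (1 + a + b) * r"
      using G(6,7) by (simp add: ratio_defect_def ratio_triple_def)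
    also have "\<dots> < 2 * (1 + a + b) * d"
      using r(2) assms(4,5) by simp
    also have "\<dots> = m"
      using assms(4,5) by (simp add: d_def)
    finally show False by simp
  qed
  ultimately show ?thesis by blast
qed

text \<open>The \<open>d\<close>-ball around \<open>F\<close> misses \<open>N\<close>, so
  \<open>F\<close> is outside the closure of \<open>N\<close>. Such \<open>F\<close> occur in every
  ball, so the closure contains no ball.\<close>

lemma nowhere_dense_in_hausdorff_topologyI:
  assumes "N \<subseteq> compact_subsets S"
    and sep: "\<And>E e. E \<in> compact_subsets S \<Longrightarrow> 0 < e \<Longrightarrow>
      \<exists>F\<in>compact_subsets S. hausdorff_dist E F < e \<and> (\<exists>d>0. \<forall>G\<in>N. d \<le> hausdorff_dist F G)"
  shows "nowhere_dense_in (hausdorff_topology S) N"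
proof -
  interpret Metric_space "compact_subsets S" hausdorff_dist
    by (rule Metric_space_hausdorff_dist)
  have "E \<notin> mtopology interior_of (mtopology closure_of N)" for E
  proof
    assume E: "E \<in> mtopology interior_of (mtopology closure_of N)"
    then obtain e where e: "0 < e" "mball E e \<subseteq> mtopology interior_of (mtopology closure_of N)"
      using openin_interior_of[of mtopology "mtopology closure_of N"] unfolding openin_mtopology by blast
    have "E \<in> compact_subsets S"
      using E interior_of_subset_topspace[of mtopology] by auto
    then obtain F d where F: "F \<in> compact_subsets S" "hausdorff_dist E F < e" "0 < d"
      "\<And>G. G \<in> N \<Longrightarrow> d \<le> hausdorff_dist F G"
      using sep e(1) by blast
    then have "F \<in> mball E e"
      using \<open>E \<in> compact_subsets S\<close> by (simp add: in_mball)
    then have "F \<in> mtopology closure_of N"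
      using e(2) interior_of_subset[of mtopology "mtopology closure_of N"] by blast
    then obtain G where "G \<in> N" "hausdorff_dist F G < d"
      using F(3) by (auto simp: metric_closure_of in_mball)
    then show False using F(4) by force
  qed
  then show ?thesis
    using assms(1) by (auto simp: nowhere_dense_in_def hausdorff_topology_def)
qed

lemma typical_no_similar_copy:
  fixes S P :: "'a::euclidean_space set"
  assumes "S \<subseteq> closure (interior S)" "card P = 3"
  shows "typical_in (hausdorff_topology S) (\<lambda>E. \<not> contains_similar_copy E P)"
proof -
  obtain p q r where P: "P = {p, q, r}" "p \<noteq> q" "q \<noteq> r" "p \<noteq> r"
    using assms(2) by (auto simp: card_3_iff)
  define a b where "a = dist p r / dist p q" and "b = dist q r / dist p q"
  have ab: "0 < a" "0 < b" using P by (auto simp: a_def b_def)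
  \<comment> \<open>The lower bound on the first side makes \<open>ratio_free_separated\<close>
    applicable with one \<open>s\<close> for all members. The similar copy is kept as a condition
    because \<open>first_category_in\<close> asks for equality with the union, not mere
    inclusion.\<close>
  define N where "N n = {E \<in> compact_subsets S. contains_similar_copy E P \<and>
    (\<exists>x\<in>E. \<exists>y\<in>E. \<exists>z\<in>E. ratio_triple a b x y z \<and> inverse (real (Suc n)) \<le> dist x y)}" for n
  have "nowhere_dense_in (hausdorff_topology S) (N n)" for n
  proof (rule nowhere_dense_in_hausdorff_topologyI)
    fix E :: "'a set" and e :: real
    assume "E \<in> compact_subsets S" "0 < e"
    then obtain F where F: "F \<in> compact_subsets S" "finite F" "ratio_free a b F"
      "hausdorff_dist E F < e"
      using ratio_free_dense[OF assms(1) _ _ ab] by blast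
    have "F \<noteq> {}" using F(1) by (simp add: compact_subsets_def)
    obtain d where d: "0 < d" "\<And>G. G \<noteq> {} \<and> bounded G \<and>
      (\<exists>x\<in>G. \<exists>y\<in>G. \<exists>z\<in>G. ratio_triple a b x y z \<and> inverse (real (Suc n)) \<le> dist x y) \<Longrightarrow>
      d \<le> hausdorff_dist F G"
      using ratio_free_separated[OF F(2) \<open>F \<noteq> {}\<close> F(3) ab, of "inverse (real (Suc n))"]
      by auto
    have "d \<le> hausdorff_dist F G" if "G \<in> N n" for G
      using that by (intro d(2)) (auto simp: N_def compact_subsets_def compact_imp_bounded)
    then show "\<exists>F\<in>compact_subsets S. hausdorff_dist E F < e \<and>
      (\<exists>d>0. \<forall>G\<in>N n. d \<le> hausdorff_dist F G)"
      using F(1,4) d(1) by blast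
  qed (auto simp: N_def)
  moreover have "{E \<in> compact_subsets S. contains_similar_copy E P} = \<Union>(range N)"
  proof (intro equalityI subsetI)
    fix E assume E: "E \<in> {E \<in> compact_subsets S. contains_similar_copy E P}"
    then obtain x y z where xyz: "x \<in> E" "y \<in> E" "z \<in> E" "ratio_triple a b x y z"
      using contains_similar_copy_ratio_triple[of E p q r] P by (auto simp: a_def b_def)
    then obtain n where "inverse (real (Suc n)) < dist x y"
      using reals_Archimedean[of "dist x y"] by (auto simp: ratio_triple_def)
    then have "E \<in> N n" using E xyz by (auto simp: N_def intro: less_imp_le)
    then show "E \<in> \<Union>(range N)" by blast
  qed (auto simp: N_def)
  ultimately show ?thesis
    by (auto simp: typical_in_def first_category_in_def intro!: exI[of _ "range N"])
qed

theorem theorem1p1: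
  fixes P :: "(real ^ 'n) set"
  assumes "card P = 3"
  shows "typical_in (hausdorff_topology (cbox (0 :: real ^ 'n) 1)) (\<lambda>E. \<not> contains_similar_copy E P)"
proof (rule typical_no_similar_copy[OF _ assms])
  \<comment> \<open>The centre of the cube shows that the open box is nonempty, so that
    \<open>closure_box\<close> returns the closed cube.\<close>
  have "(\<chi> i. 1 / 2) \<in> box (0 :: real ^ 'n) 1"
    by (simp add: mem_box_cart)
  then have "box (0 :: real ^ 'n) 1 \<noteq> {}"
    by blast
  then show "cbox 0 1 \<subseteq> closure (interior (cbox (0 :: real ^ 'n) 1))"
    by (simp add: interior_cbox closure_box)
qed

end
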